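(* Suppose $q_0$ is the central affine curvature of $\gamma_0\in\mathcal{M}_2(S^1)$, and $q(x,t)$ is the solution of the KdV equation $q_t=\frac14(q_{xxx}-6qq_x)$, periodic in $x$ with period $2\pi$, such that $q(x,0)=q_0(x)$. Let $g:\mathbb{R}^2\to SL(2,\mathbb{R})$ be the solution of the linear system $$g_x=g\begin{pmatrix}0&q\\1&0\end{pmatrix},\qquad g_t=g\begin{pmatrix}\frac14q_x&\frac14(q_{xx}-2q^2)\\-\frac q2&-\frac14q_x\end{pmatrix}$$ with initial data $g(0,0)=(\gamma_0(0),(\gamma_0)_x(0))$ (the $2\times2$ matrix with these columns). Then $\gamma(x,t)=g(x,t)(1,0)^t$ is a solution of the central affine curve flow $$\gamma_t=\tfrac14q_x\gamma-\tfrac12q\gamma_x$$ (where $q(\cdot,t)$ is the central affine curvature of $\gamma(\cdot,t)$) with initial data $\gamma(x,0)=\gamma_0(x)$, and $\gamma(x,t)$ is periodic in $x$ with period $2\pi$.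
   Context: $S^1=\mathbb{R}/2\pi\mathbb{Z}$, and functions on $S^1$ are identified with $2\pi$-periodic functions on $\mathbb{R}$. $\mathcal{M}_2(S^1)$ is the set of smooth closed curves $\gamma:S^1\to\mathbb{R}^2\setminus\{0\}$ (column vectors) with $\det(\gamma,\gamma_x)=1$. For a curve with $\det(\gamma,\gamma_x)=1$ there is a unique smooth function $q$ with $\gamma_{xx}=q\gamma$, called the central affine curvature of $\gamma$. A solution of the curve flow is a smooth map $\gamma(x,t)$ with $\det(\gamma,\gamma_x)=1$ satisfying the stated evolution equation, $q(\cdot,t)$ being the central affine curvature of $\gamma(\cdot,t)$. It is known that the KdV equation with smooth periodic initial data has a unique smooth global periodic solution. *)

theory Defs
  imports "HOL-Analysis.Analysis"
begin

text \<open>Smoothness on a whole Euclidean space: for every \<open>n\<close>, all iterated directional derivatives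
  of order at most \<open>n\<close> exist (as Frechet derivatives) and are continuous.\<close>

primrec Ck :: "nat \<Rightarrow> ('a::euclidean_space \<Rightarrow> 'b::real_normed_vector) \<Rightarrow> bool" where
  "Ck 0 f \<longleftrightarrow> continuous_on UNIV f"
| "Ck (Suc n) f \<longleftrightarrow>
     f differentiable_on UNIV \<and> (\<forall>v. Ck n (\<lambda>x. frechet_derivative f (at x) v))"

definition smooth_map :: "('a::euclidean_space \<Rightarrow> 'b::real_normed_vector) \<Rightarrow> bool" where
  "smooth_map f \<longleftrightarrow> (\<forall>n. Ck n f)"

text \<open>Derivatives are total functions in HOL, so every use below comes with a
  differentiability hypothesis.\<close>

definition D :: "(real \<Rightarrow> 'b::real_normed_vector) \<Rightarrow> real \<Rightarrow> 'b" where
  "D f x = vector_derivative f (at x)"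

definition Dx :: "(real \<Rightarrow> real \<Rightarrow> 'b::real_normed_vector) \<Rightarrow> real \<Rightarrow> real \<Rightarrow> 'b" where
  "Dx f x t = D (\<lambda>s. f s t) x"

definition Dt :: "(real \<Rightarrow> real \<Rightarrow> 'b::real_normed_vector) \<Rightarrow> real \<Rightarrow> real \<Rightarrow> 'b" where
  "Dt f x t = D (f x) t"

text \<open>\<open>vector\<close> lists the rows of a matrix, hence the transposition.\<close>

definition columns2 :: "real^2 \<Rightarrow> real^2 \<Rightarrow> real^2^2" where
  "columns2 v w = transpose (vector [v, w])"

lemma det_columns2: "det (columns2 v w) = v$1 * w$2 - v$2 * w$1"
  by (simp add: columns2_def transpose_def det_2)

definition central_affine_curves :: "(real \<Rightarrow> real^2) set" where
  "central_affine_curves =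
     {\<gamma>. smooth_map \<gamma> \<and> (\<forall>x. \<gamma> x \<noteq> 0) \<and> (\<forall>x. det (columns2 (\<gamma> x) (D \<gamma> x)) = 1)}"

text \<open>The set \<open>M\<^sub>2(S\<^sup>1)\<close>; functions on the circle are \<open>2\<pi>\<close>-periodic functions on the line.\<close>

definition M2_S1 :: "(real \<Rightarrow> real^2) set" where
  "M2_S1 = {\<gamma> \<in> central_affine_curves. \<forall>x. \<gamma> (x + 2 * pi) = \<gamma> x}"

definition is_central_affine_curvature :: "(real \<Rightarrow> real) \<Rightarrow> (real \<Rightarrow> real^2) \<Rightarrow> bool" where
  "is_central_affine_curvature q \<gamma> \<longleftrightarrow>
     \<gamma> \<in> central_affine_curves \<and> smooth_map q \<and> (\<forall>x. D (D \<gamma>) x = q x *\<^sub>R \<gamma> x)"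

definition KdV_solution :: "(real \<Rightarrow> real \<Rightarrow> real) \<Rightarrow> bool" where
  "KdV_solution q \<longleftrightarrow>
     smooth_map (\<lambda>(x, t). q x t) \<and>
     (\<forall>x t. Dt q x t = 1/4 * (Dx (Dx (Dx q)) x t - 6 * q x t * Dx q x t))"

text \<open>No regularity of \<open>g\<close> beyond joint differentiability in \<open>(x, t)\<close> is required.\<close>

definition frame_solution ::
    "(real \<Rightarrow> real \<Rightarrow> real) \<Rightarrow> (real \<Rightarrow> real \<Rightarrow> real^2^2) \<Rightarrow> bool" where
  "frame_solution q g \<longleftrightarrow>
     (\<lambda>(x, t). g x t) differentiable_on UNIV \<and>
     (\<forall>x t. Dx g x t = g x t ** vector [vector [0, q x t],
                                        vector [1, 0]]) \<and>
     (\<forall>x t. Dt g x t = g x t **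
        vector [vector [1/4 * Dx q x t, 1/4 * (Dx (Dx q) x t - 2 * (q x t)\<^sup>2)],
                vector [- (q x t / 2),  - (1/4 * Dx q x t)]])"

definition curve_flow_solution ::
    "(real \<Rightarrow> real \<Rightarrow> real) \<Rightarrow> (real \<Rightarrow> real \<Rightarrow> real^2) \<Rightarrow> bool" where
  "curve_flow_solution q \<gamma> \<longleftrightarrow>
     smooth_map (\<lambda>(x, t). \<gamma> x t) \<and>
     (\<forall>t. is_central_affine_curvature (\<lambda>x. q x t) (\<lambda>x. \<gamma> x t)) \<and>
     (\<forall>x t. Dt \<gamma> x t = (1/4 * Dx q x t) *\<^sub>R \<gamma> x t - (1/2 * q x t) *\<^sub>R Dx \<gamma> x t)"

end

theory Submission
  imports Defs
begin

text \<open>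
  Write the linear system as \<open>g\<^sub>x = g A\<close>, \<open>g\<^sub>t = g B\<close>.
  The first column of \<open>A\<close> is the second unit vector, so \<open>\<gamma>\<^sub>x\<close> is the second column of \<open>g\<close>; that is,
  \<open>g\<close> is the moving frame \<open>(\<gamma>, \<gamma>\<^sub>x)\<close>. Then \<open>det (\<gamma>, \<gamma>\<^sub>x) = det g = 1\<close>, the second column of
  \<open>g\<^sub>x = g A\<close> says \<open>\<gamma>\<^sub>x\<^sub>x = q \<gamma>\<close>, and the first column of \<open>g\<^sub>t = g B\<close> is the curve flow
  (\<open>frame_solution_imp_curve_flow_solution\<close>).

  The frame is smooth, although it is only given as differentiable: the derivative of \<open>g\<close> in the
  direction \<open>(a, b)\<close> is \<open>g (a A + b B)\<close>, with coefficients that inherit smoothness from \<open>q\<close>, so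
  \<open>C\<^sup>n\<close> regularity of \<open>g\<close> improves to \<open>C\<^sup>n\<^sup>+\<^sup>1\<close> (\<open>smooth_map_bootstrap\<close>).

  The initial curve and the period both come from one uniqueness principle (\<open>frame_unique\<close>).
  If \<open>F' = F A\<close>, \<open>G' = G A\<close> and \<open>det G = 1\<close>, then \<open>F G\<^sup>-\<^sup>1\<close> has derivative
  \<open>F A G\<^sup>-\<^sup>1 - F G\<^sup>-\<^sup>1 G A G\<^sup>-\<^sup>1 = 0\<close>, so \<open>F\<close> and \<open>G\<close> agree everywhere if they agree at one point.
  Along \<open>t = 0\<close> this identifies \<open>g\<close> with the frame of \<open>\<gamma>0\<close>. Since \<open>q\<close> and its
  \<open>x\<close>-derivatives are periodic, \<open>g\<close> translated by \<open>2\<pi>\<close> in \<open>x\<close> solves the same linear system, and the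
  periodicity of \<open>\<gamma>0\<close> makes it agree with \<open>g\<close> at the origin. Uniqueness along the line \<open>t = 0\<close> and
  then along every line \<open>x = const\<close> gives agreement everywhere (\<open>frame_periodic\<close>).
\<close>

section \<open>Smooth maps\<close>

lemma Ck_SucI:
  assumes "\<And>x. (f has_derivative f' x) (at x)" and "\<And>v. Ck n (\<lambda>x. f' x v)"
  shows "Ck (Suc n) f"
proof -
  have "frechet_derivative f (at x) = f' x" for x
    using frechet_derivative_at[OF assms(1)] by simp
  moreover have "f differentiable_on UNIV"
    using assms(1) by (auto simp: differentiable_on_def differentiable_def)
  ultimately show ?thesis
    using assms(2) by simp
qed

lemma Ck_Suc_has_derivative:
  assumes "Ck (Suc n) f"
  shows "(f has_derivative frechet_derivative f (at x)) (at x)"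
  using assms by (simp add: differentiable_on_def frechet_derivative_works)

lemma Ck_Suc_imp_Ck: "Ck (Suc n) f \<Longrightarrow> Ck n f"
proof (induction n arbitrary: f)
  case 0
  then show ?case by (simp add: differentiable_imp_continuous_on)
next
  case (Suc n)
  from Suc.prems have "\<And>v. Ck (Suc n) (\<lambda>x. frechet_derivative f (at x) v)"
    and "f differentiable_on UNIV"
    by (simp_all only: Ck.simps(2)[of "Suc n"])
  then show ?case using Suc.IH by simp
qed

lemma Ck_const: "Ck n (\<lambda>x. c)"
proof (induction n arbitrary: c)
  case (Suc n)
  then show ?case by (intro Ck_SucI[where f' = "\<lambda>_ _. 0"]) auto
qed simp

lemma Ck_add: "Ck n f \<Longrightarrow> Ck n g \<Longrightarrow> Ck n (\<lambda>x. f x + g x)"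
proof (induction n arbitrary: f g)
  case 0
  then show ?case by (simp add: continuous_on_add)
next
  case (Suc n)
  show ?case
  proof (rule Ck_SucI)
    show "((\<lambda>x. f x + g x) has_derivative
        (\<lambda>v. frechet_derivative f (at x) v + frechet_derivative g (at x) v)) (at x)" for x
      using Suc.prems by (intro has_derivative_add Ck_Suc_has_derivative)
    show "Ck n (\<lambda>x. frechet_derivative f (at x) v + frechet_derivative g (at x) v)" for v
      using Suc by simp
  qed
qed

text \<open>The product rule leaves terms in \<open>f\<close> and \<open>g\<close> themselves, so the induction needs these
  at the lower order too; \<open>Ck_Suc_imp_Ck\<close> supplies that.\<close>

lemma Ck_bilinear:
  assumes "bounded_bilinear bop"
  shows "Ck n f \<Longrightarrow> Ck n g \<Longrightarrow> Ck n (\<lambda>x. bop (f x) (g x))"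
proof (induction n arbitrary: f g)
  case 0
  then show ?case by (simp add: bounded_bilinear.continuous_on[OF assms])
next
  case (Suc n)
  show ?case
  proof (rule Ck_SucI)
    show "((\<lambda>x. bop (f x) (g x)) has_derivative
        (\<lambda>v. bop (f x) (frechet_derivative g (at x) v)
           + bop (frechet_derivative f (at x) v) (g x))) (at x)" for x
      using Suc.prems by (intro bounded_bilinear.FDERIV[OF assms] Ck_Suc_has_derivative)
    show "Ck n (\<lambda>x. bop (f x) (frechet_derivative g (at x) v)
           + bop (frechet_derivative f (at x) v) (g x))" for v
      using Suc.prems Suc.prems[THEN Ck_Suc_imp_Ck] by (intro Ck_add Suc.IH) simp_all
  qed
qed

text \<open>For an affine inner map the chain rule is again a composition with the same inner map, with the
  fixed direction \<open>v\<close> replaced by \<open>L v\<close>; so the induction closes without any product rule.\<close>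

lemma Ck_compose_affine:
  fixes L :: "'a::euclidean_space \<Rightarrow> 'b::euclidean_space"
    and f :: "'b \<Rightarrow> 'c::real_normed_vector"
  assumes L: "bounded_linear L"
  shows "Ck n f \<Longrightarrow> Ck n (\<lambda>x. f (c + L x))"
proof (induction n arbitrary: f)
  case 0
  then show ?case
    by (auto intro!: continuous_on_compose2[of UNIV f] continuous_intros
        bounded_linear.continuous_on[OF L])
next
  case (Suc n)
  show ?case
  proof (rule Ck_SucI)
    show "((\<lambda>x. f (c + L x)) has_derivative
        (\<lambda>v. frechet_derivative f (at (c + L x)) (L v))) (at x)" for x
      by (rule has_derivative_compose[OF _ Ck_Suc_has_derivative[OF Suc.prems]])
        (auto intro!: derivative_eq_intros bounded_linear_imp_has_derivative[OF L])
    show "Ck n (\<lambda>x. frechet_derivative f (at (c + L x)) (L v))" for v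
      using Suc.prems by (intro Suc.IH) simp
  qed
qed

lemma smooth_map_const: "smooth_map (\<lambda>x. c)"
  by (simp add: smooth_map_def Ck_const)

lemma smooth_map_add:
  "smooth_map f \<Longrightarrow> smooth_map g \<Longrightarrow> smooth_map (\<lambda>x. f x + g x)"
  by (simp add: smooth_map_def Ck_add)

lemma smooth_map_bilinear:
  "bounded_bilinear bop \<Longrightarrow> smooth_map f \<Longrightarrow> smooth_map g \<Longrightarrow> smooth_map (\<lambda>x. bop (f x) (g x))"
  by (simp add: smooth_map_def Ck_bilinear)

lemmas smooth_map_scaleR = smooth_map_bilinear[OF bounded_bilinear_scaleR]
  and smooth_map_mult = smooth_map_bilinear[OF bounded_bilinear_mult]

lemma smooth_map_has_derivative:
  "smooth_map f \<Longrightarrow> (f has_derivative frechet_derivative f (at x)) (at x)"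
  by (auto simp: smooth_map_def intro: Ck_Suc_has_derivative)

lemma smooth_map_directional_derivative:
  assumes "smooth_map f"
  shows "smooth_map (\<lambda>x. frechet_derivative f (at x) v)"
  unfolding smooth_map_def
proof
  fix n
  have "Ck (Suc n) f" using assms by (simp only: smooth_map_def)
  then show "Ck n (\<lambda>x. frechet_derivative f (at x) v)" by simp
qed

text \<open>The equation expresses every first derivative of \<open>f\<close> through \<open>f\<close> itself and smooth
  coefficients. If \<open>f\<close> is \<open>C\<^sup>n\<close> then so are its derivatives, and \<open>f\<close> is of the next class; continuity
  of a differentiable map starts the induction.\<close>

lemma smooth_map_bootstrap:
  assumes bop: "bounded_bilinear bop"
    and deriv: "\<And>x. (f has_derivative (\<lambda>v. bop (f x) (a v x))) (at x)"
    and smooth: "\<And>v. smooth_map (a v)"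
  shows "smooth_map f"
  unfolding smooth_map_def
proof
  show "Ck n f" for n
  proof (induction n)
    case 0
    have "f differentiable_on UNIV"
      using deriv by (auto simp: differentiable_on_def differentiable_def)
    then show ?case by (simp add: differentiable_imp_continuous_on)
  next
    case (Suc n)
    show ?case
      using Suc smooth by (intro Ck_SucI[OF deriv] Ck_bilinear[OF bop]) (simp_all add: smooth_map_def)
  qed
qed

section \<open>Curves and partial derivatives\<close>

lemma smooth_map_has_vector_derivative:
  "smooth_map f \<Longrightarrow> (f has_vector_derivative D f x) (at x)"
  unfolding D_def vector_derivative_works[symmetric]
  by (meson differentiable_def smooth_map_has_derivative)

lemma smooth_map_D:
  assumes "smooth_map f"
  shows "smooth_map (D f)"
proof -
  have "D f = (\<lambda>x. frechet_derivative f (at x) 1)"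
  proof
    fix x
    have "frechet_derivative f (at x) = (\<lambda>h. h *\<^sub>R D f x)"
      using frechet_derivative_at[OF
          smooth_map_has_vector_derivative[OF assms, unfolded has_vector_derivative_def]]
      by simp
    then show "D f x = frechet_derivative f (at x) 1" by simp
  qed
  then show ?thesis
    using smooth_map_directional_derivative[OF assms] by simp
qed

lemma has_vector_derivative_imp_D: "(f has_vector_derivative f') (at x) \<Longrightarrow> D f x = f'"
  unfolding D_def by (rule vector_derivative_at)

text \<open>Joint differentiability connects the curried partial derivatives with the total derivative
  of the uncurried map, in which smoothness is expressed.\<close>

lemma partial_derivatives:
  fixes f :: "real \<Rightarrow> real \<Rightarrow> 'b::real_normed_vector"
  assumes "((\<lambda>(x, t). f x t) has_derivative f') (at (x, t))"
  shows "((\<lambda>s. f s t) has_vector_derivative f' (1, 0)) (at x)"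
    and "(f x has_vector_derivative f' (0, 1)) (at t)"
proof -
  interpret bounded_linear f' using assms by (rule has_derivative_bounded_linear)
  have "((\<lambda>s. (\<lambda>(x, t). f x t) (s, t)) has_derivative (\<lambda>h. f' (h, 0))) (at x)"
    by (rule has_derivative_compose[where f = "\<lambda>s. (s, t)" and g = "\<lambda>(x, t). f x t", OF _ assms])
      (auto intro!: derivative_eq_intros)
  then show "((\<lambda>s. f s t) has_vector_derivative f' (1, 0)) (at x)"
    by (simp add: has_vector_derivative_def scaleR[symmetric])
  have "((\<lambda>s. (\<lambda>(x, t). f x t) (x, s)) has_derivative (\<lambda>h. f' (0, h))) (at t)"
    by (rule has_derivative_compose[where f = "Pair x" and g = "\<lambda>(x, t). f x t", OF _ assms])
      (auto intro!: derivative_eq_intros)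
  then show "(f x has_vector_derivative f' (0, 1)) (at t)"
    by (simp add: has_vector_derivative_def scaleR[symmetric])
qed

lemma has_partial_derivatives:
  fixes f :: "real \<Rightarrow> real \<Rightarrow> 'b::real_normed_vector"
  assumes "(\<lambda>(x, t). f x t) differentiable (at (x, t))"
  shows "((\<lambda>s. f s t) has_vector_derivative Dx f x t) (at x)"
    and "(f x has_vector_derivative Dt f x t) (at t)"
    and "((\<lambda>(x, t). f x t) has_derivative (\<lambda>(a, b). a *\<^sub>R Dx f x t + b *\<^sub>R Dt f x t)) (at (x, t))"
proof -
  obtain f' where f': "((\<lambda>(x, t). f x t) has_derivative f') (at (x, t))"
    using assms unfolding differentiable_def by blast
  note partial = partial_derivatives[OF f']
  have D: "Dx f x t = f' (1, 0)" "Dt f x t = f' (0, 1)"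
    unfolding Dx_def Dt_def by (intro has_vector_derivative_imp_D partial)+
  show "((\<lambda>s. f s t) has_vector_derivative Dx f x t) (at x)"
    and "(f x has_vector_derivative Dt f x t) (at t)"
    using partial by (simp_all add: D)
  interpret bounded_linear f' using f' by (rule has_derivative_bounded_linear)
  have "f' = (\<lambda>(a, b). a *\<^sub>R Dx f x t + b *\<^sub>R Dt f x t)"
    by (auto simp: D scaleR[symmetric] add[symmetric])
  then show "((\<lambda>(x, t). f x t) has_derivative (\<lambda>(a, b). a *\<^sub>R Dx f x t + b *\<^sub>R Dt f x t)) (at (x, t))"
    using f' by simp
qed

lemma smooth_map_Dx:
  assumes "smooth_map (\<lambda>(x, t). f x t)"
  shows "smooth_map (\<lambda>(x, t). Dx f x t)"
proof -
  have "Dx f x t = frechet_derivative (\<lambda>(x, t). f x t) (at (x, t)) (1, 0)" for x t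
    unfolding Dx_def
    by (intro has_vector_derivative_imp_D partial_derivatives(1) smooth_map_has_derivative assms)
  then show ?thesis
    using smooth_map_directional_derivative[OF assms, of "(1, 0)"]
    by (simp add: case_prod_beta')
qed

lemma smooth_map_slice:
  assumes "smooth_map (\<lambda>(x::real, t::real). f x t)"
  shows "smooth_map (\<lambda>x. f x t)"
proof -
  have "bounded_linear (\<lambda>x::real. (x, 0::real))"
    by (intro bounded_linear_Pair bounded_linear_ident bounded_linear_zero)
  from Ck_compose_affine[OF this, of _ "\<lambda>(x, t). f x t" "(0, t)"] show ?thesis
    using assms by (simp add: smooth_map_def)
qed

section \<open>Frames\<close>

lemma bounded_bilinear_matrix_matrix_mult:
  "bounded_bilinear ((**) :: real^'n^'m \<Rightarrow> real^'k^'n \<Rightarrow> real^'k^'m)"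
  unfolding bilinear_conv_bounded_bilinear[symmetric] bilinear_def
  by (auto intro!: linearI simp: vec_eq_iff matrix_matrix_mult_def sum.distrib
      sum_distrib_left algebra_simps)

lemma bounded_bilinear_matrix_vector_mult:
  "bounded_bilinear ((*v) :: real^'n^'m \<Rightarrow> real^'n \<Rightarrow> real^'m)"
  unfolding bilinear_conv_bounded_bilinear[symmetric] bilinear_def
  by (auto intro!: linearI simp: vec_eq_iff matrix_vector_mult_def sum.distrib
      sum_distrib_left algebra_simps)

text \<open>Smoothness is compatible with sums and scalar multiples; this expansion in matrix units
  reduces the smoothness of a matrix to that of its entries.\<close>

lemma vector_2x2_eq_combination:
  "(vector [vector [a, b], vector [c, d]] :: real^2^2) =
     a *\<^sub>R vector [vector [1, 0], vector [0, 0]] + b *\<^sub>R vector [vector [0, 1], vector [0, 0]]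
   + c *\<^sub>R vector [vector [0, 0], vector [1, 0]] + d *\<^sub>R vector [vector [0, 0], vector [0, 1]]"
  by (simp add: vec_eq_iff forall_2)

lemma smooth_map_2x2:
  assumes "smooth_map a" "smooth_map b" "smooth_map c" "smooth_map d"
  shows "smooth_map (\<lambda>p. vector [vector [a p, b p], vector [c p, d p]] :: real^2^2)"
  by (subst vector_2x2_eq_combination)
    (intro smooth_map_add smooth_map_scaleR smooth_map_const assms)

text \<open>For determinant \<open>1\<close> this is the inverse. Unlike the inverse it is linear in \<open>M\<close>, so it can be
  differentiated along a curve of matrices at no cost.\<close>

definition adjugate2 :: "real^2^2 \<Rightarrow> real^2^2" where
  "adjugate2 M = vector [vector [M$2$2, - M$1$2], vector [- M$2$1, M$1$1]]"

lemma adjugate2_mult: "adjugate2 (M ** N) = adjugate2 N ** adjugate2 M"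
  by (simp add: adjugate2_def vec_eq_iff forall_2 matrix_matrix_mult_def sum_2)

lemma adjugate2_left_right:
  "M ** adjugate2 M = det M *\<^sub>R mat 1" "adjugate2 M ** M = det M *\<^sub>R mat 1"
  by (simp_all add: adjugate2_def vec_eq_iff forall_2 matrix_matrix_mult_def sum_2 det_2 mat_def)

lemma adjugate2_trace_free: "trace M = 0 \<Longrightarrow> adjugate2 M = - M"
  by (simp add: adjugate2_def vec_eq_iff forall_2 trace_def sum_2)

lemma bounded_linear_adjugate2: "bounded_linear adjugate2"
  unfolding linear_conv_bounded_linear[symmetric]
  by (auto intro!: linearI simp: adjugate2_def vec_eq_iff forall_2)

text \<open>The matrix \<open>F G\<^sup>-\<^sup>1\<close> is constant. With \<open>G\<^sup>-\<^sup>1\<close> written as the adjugate, its derivative is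
  \<open>F (A + adj A) (adj G)\<close>, and \<open>A + adj A\<close> vanishes because \<open>A\<close> is trace-free.\<close>

lemma frame_unique:
  fixes F G A :: "real \<Rightarrow> real^2^2"
  assumes F: "\<And>s. (F has_vector_derivative F s ** A s) (at s)"
    and G: "\<And>s. (G has_vector_derivative G s ** A s) (at s)"
    and trace: "\<And>s. trace (A s) = 0"
    and det: "\<And>s. det (G s) = 1"
    and init: "F a = G a"
  shows "F s = G s"
proof -
  have "((\<lambda>s. F s ** adjugate2 (G s)) has_vector_derivative 0) (at s)" for s
  proof -
    have "((\<lambda>s. F s ** adjugate2 (G s)) has_vector_derivative
        F s ** adjugate2 (G s ** A s) + (F s ** A s) ** adjugate2 (G s)) (at s)"
      by (intro bounded_bilinear.has_vector_derivative[OF bounded_bilinear_matrix_matrix_mult]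
          bounded_linear.has_vector_derivative[OF bounded_linear_adjugate2] F G)
    moreover have "F s ** adjugate2 (G s ** A s) = - ((F s ** A s) ** adjugate2 (G s))"
      unfolding adjugate2_mult adjugate2_trace_free[OF trace]
      by (simp add: matrix_mul_assoc
          bounded_bilinear.minus_left[OF bounded_bilinear_matrix_matrix_mult]
          bounded_bilinear.minus_right[OF bounded_bilinear_matrix_matrix_mult])
    ultimately show ?thesis by simp
  qed
  then obtain C where C: "\<And>s. F s ** adjugate2 (G s) = C"
    using has_vector_derivative_zero_constant[of UNIV "\<lambda>s. F s ** adjugate2 (G s)"] by auto
  have "C = mat 1"
    using C[of a] by (simp add: init adjugate2_left_right det)
  have "F s = F s ** (adjugate2 (G s) ** G s)"
    by (simp add: adjugate2_left_right det)
  also have "\<dots> = C ** G s"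
    by (simp add: matrix_mul_assoc C)
  finally show ?thesis
    by (simp add: \<open>C = mat 1\<close>)
qed

definition frame_x_coeff :: "(real \<Rightarrow> real \<Rightarrow> real) \<Rightarrow> real \<Rightarrow> real \<Rightarrow> real^2^2" where
  "frame_x_coeff q x t = vector [vector [0, q x t], vector [1, 0]]"

definition frame_t_coeff :: "(real \<Rightarrow> real \<Rightarrow> real) \<Rightarrow> real \<Rightarrow> real \<Rightarrow> real^2^2" where
  "frame_t_coeff q x t =
     vector [vector [1/4 * Dx q x t, 1/4 * (Dx (Dx q) x t - 2 * (q x t)\<^sup>2)],
             vector [- (q x t / 2),  - (1/4 * Dx q x t)]]"

lemma trace_frame_coeffs: "trace (frame_x_coeff q x t) = 0" "trace (frame_t_coeff q x t) = 0"
  by (simp_all add: frame_x_coeff_def frame_t_coeff_def trace_def sum_2)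

lemma smooth_map_frame_coeffs:
  assumes q: "smooth_map (\<lambda>(x, t). q x t)"
  shows "smooth_map (\<lambda>(x, t). frame_x_coeff q x t)"
    and "smooth_map (\<lambda>(x, t). frame_t_coeff q x t)"
proof -
  note q1 = smooth_map_Dx[OF q] and q2 = smooth_map_Dx[OF smooth_map_Dx[OF q]]
  note q' = q[unfolded case_prod_beta'] q1[unfolded case_prod_beta'] q2[unfolded case_prod_beta']
  show "smooth_map (\<lambda>(x, t). frame_x_coeff q x t)"
    unfolding frame_x_coeff_def case_prod_beta'
    by (intro smooth_map_2x2 smooth_map_const q')
  \<comment> \<open>Entries rewritten with sums and products only, the operations that are known to preserve
    smoothness.\<close>
  have eq: "frame_t_coeff q x t =
      vector [vector [1/4 * Dx q x t, 1/4 * Dx (Dx q) x t + (-1/2) * (q x t * q x t)],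
              vector [(-1/2) * q x t,  (-1/4) * Dx q x t]]" for x t
    by (simp add: frame_t_coeff_def algebra_simps power2_eq_square)
  show "smooth_map (\<lambda>(x, t). frame_t_coeff q x t)"
    unfolding eq case_prod_beta'
    by (intro smooth_map_2x2 smooth_map_const smooth_map_add smooth_map_mult q')
qed

lemma frame_solution_derivatives:
  assumes "frame_solution q g"
  shows "((\<lambda>s. g s t) has_vector_derivative g x t ** frame_x_coeff q x t) (at x)"
    and "(g x has_vector_derivative g x t ** frame_t_coeff q x t) (at t)"
    and "((\<lambda>(x, t). g x t) has_derivative
           (\<lambda>(a, b). g x t ** (a *\<^sub>R frame_x_coeff q x t + b *\<^sub>R frame_t_coeff q x t))) (at (x, t))"
proof -
  have diff: "(\<lambda>(x, t). g x t) differentiable (at (x, t))"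
    and D: "Dx g x t = g x t ** frame_x_coeff q x t" "Dt g x t = g x t ** frame_t_coeff q x t"
    using assms by (simp_all add: frame_solution_def differentiable_on_def
        frame_x_coeff_def frame_t_coeff_def)
  interpret bounded_bilinear "(**) :: real^2^2 \<Rightarrow> real^2^2 \<Rightarrow> real^2^2"
    by (rule bounded_bilinear_matrix_matrix_mult)
  show "((\<lambda>s. g s t) has_vector_derivative g x t ** frame_x_coeff q x t) (at x)"
    and "(g x has_vector_derivative g x t ** frame_t_coeff q x t) (at t)"
    and "((\<lambda>(x, t). g x t) has_derivative
           (\<lambda>(a, b). g x t ** (a *\<^sub>R frame_x_coeff q x t + b *\<^sub>R frame_t_coeff q x t))) (at (x, t))"
    using has_partial_derivatives[OF diff] by (simp_all add: D add_right scaleR_right)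
qed

lemma smooth_map_frame:
  assumes q: "smooth_map (\<lambda>(x, t). q x t)" and g: "frame_solution q g"
  shows "smooth_map (\<lambda>(x, t). g x t)"
proof (rule smooth_map_bootstrap[OF bounded_bilinear_matrix_matrix_mult])
  let ?a = "\<lambda>(v::real \<times> real) (p::real \<times> real).
    fst v *\<^sub>R (\<lambda>(x, t). frame_x_coeff q x t) p + snd v *\<^sub>R (\<lambda>(x, t). frame_t_coeff q x t) p"
  show "((\<lambda>(x, t). g x t) has_derivative (\<lambda>v. (\<lambda>(x, t). g x t) p ** ?a v p)) (at p)" for p
    using frame_solution_derivatives(3)[OF g, of "fst p" "snd p"]
    by (simp add: case_prod_beta')
  show "smooth_map (?a v)" for v
    by (intro smooth_map_add smooth_map_scaleR smooth_map_const smooth_map_frame_coeffs q)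
qed

text \<open>The linear system read off column by column: with \<open>\<gamma> = g e\<^sub>1\<close>, these are \<open>\<gamma>\<^sub>x = g e\<^sub>2\<close>,
  \<open>\<gamma>\<^sub>x\<^sub>x = q \<gamma>\<close>, the curve flow, and \<open>(\<gamma>, \<gamma>\<^sub>x) = g\<close>.\<close>

lemma frame_columns:
  fixes M :: "real^2^2"
  shows "(M ** frame_x_coeff q x t) *v vector [1, 0] = M *v vector [0, 1]"
    and "(M ** frame_x_coeff q x t) *v vector [0, 1] = q x t *\<^sub>R (M *v vector [1, 0])"
    and "(M ** frame_t_coeff q x t) *v vector [1, 0] =
          (1/4 * Dx q x t) *\<^sub>R (M *v vector [1, 0]) - (1/2 * q x t) *\<^sub>R (M *v vector [0, 1])"
    and "columns2 (M *v vector [1, 0]) (M *v vector [0, 1]) = M"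
  by (simp_all add: frame_x_coeff_def frame_t_coeff_def columns2_def transpose_def vec_eq_iff forall_2
      matrix_matrix_mult_def matrix_vector_mult_def sum_2 algebra_simps)

section \<open>The curve flow\<close>

lemma frame_solution_imp_curve_flow_solution:
  assumes q: "smooth_map (\<lambda>(x, t). q x t)"
    and g: "frame_solution q g" and det: "\<And>x t. det (g x t) = 1"
  shows "curve_flow_solution q (\<lambda>x t. g x t *v vector [1, 0])"
proof -
  let ?\<gamma> = "\<lambda>x t. g x t *v vector [1, 0]"
  have mult_vector: "((\<lambda>s. G s *v w) has_vector_derivative G' *v w) (at s)"
    if "(G has_vector_derivative G') (at s)" for G :: "real \<Rightarrow> real^2^2" and G' w s
    using that by (rule bounded_linear.has_vector_derivative
        [OF bounded_bilinear.bounded_linear_left[OF bounded_bilinear_matrix_vector_mult]])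
  have Dx: "D (\<lambda>x. ?\<gamma> x t) = (\<lambda>x. g x t *v vector [0, 1])" for t
    using mult_vector[OF frame_solution_derivatives(1)[OF g, where t = t], where w = "vector [1, 0]"]
    by (auto intro!: has_vector_derivative_imp_D simp: frame_columns)
  have DDx: "D (\<lambda>x. g x t *v vector [0, 1]) x = q x t *\<^sub>R ?\<gamma> x t" for x t
    using mult_vector[OF frame_solution_derivatives(1)[OF g, where t = t], where w = "vector [0, 1]"]
    by (auto intro!: has_vector_derivative_imp_D simp: frame_columns)
  have Dt: "Dt ?\<gamma> x t = (1/4 * Dx q x t) *\<^sub>R ?\<gamma> x t - (1/2 * q x t) *\<^sub>R (g x t *v vector [0, 1])"
    for x t
    using mult_vector[OF frame_solution_derivatives(2)[OF g, of x t], where w = "vector [1, 0]"]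
    unfolding Dt_def by (auto intro!: has_vector_derivative_imp_D simp: frame_columns)
  have smooth: "smooth_map (\<lambda>(x, t). ?\<gamma> x t)"
    using smooth_map_bilinear[OF bounded_bilinear_matrix_vector_mult
        smooth_map_frame[OF q g] smooth_map_const]
    by (simp add: case_prod_beta')
  have "is_central_affine_curvature (\<lambda>x. q x t) (\<lambda>x. ?\<gamma> x t)" for t
  proof -
    have det1: "det (columns2 (?\<gamma> x t) (D (\<lambda>x. ?\<gamma> x t) x)) = 1" for x
      by (simp add: Dx frame_columns det)
    moreover have "?\<gamma> x t \<noteq> 0" for x
    proof
      assume "?\<gamma> x t = 0"
      with det1[of x] show False by (simp add: det_columns2)
    qed
    ultimately show ?thesis
      using smooth_map_slice[OF smooth] smooth_map_slice[OF q]
      by (simp add: is_central_affine_curvature_def central_affine_curves_def Dx DDx)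
  qed
  then show ?thesis
    using smooth by (simp add: curve_flow_solution_def Dt Dx_def[of ?\<gamma>] Dx)
qed

section \<open>Initial data and periodicity\<close>

text \<open>This is the equation \<open>\<gamma>'' = k \<gamma>\<close> as a first-order system; it places the frame of the initial
  curve under the same equation as the restriction of \<open>g\<close> to \<open>t = 0\<close>.\<close>

lemma central_affine_frame_derivative:
  assumes "is_central_affine_curvature k \<gamma>" and "k x = q x t"
  shows "((\<lambda>x. columns2 (\<gamma> x) (D \<gamma> x)) has_vector_derivative
           columns2 (\<gamma> x) (D \<gamma> x) ** frame_x_coeff q x t) (at x)"
proof -
  have smooth: "smooth_map \<gamma>" and DD: "D (D \<gamma>) x = k x *\<^sub>R \<gamma> x"
    using assms(1) by (auto simp: is_central_affine_curvature_def central_affine_curves_def)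
  have linear: "bounded_linear (\<lambda>(v, w). columns2 v w)"
    unfolding linear_conv_bounded_linear[symmetric]
    by (auto intro!: linearI simp: columns2_def transpose_def vec_eq_iff forall_2)
  have "((\<lambda>x. (\<gamma> x, D \<gamma> x)) has_vector_derivative (D \<gamma> x, D (D \<gamma>) x)) (at x)"
    by (intro has_vector_derivative_Pair smooth_map_has_vector_derivative smooth_map_D smooth)
  from bounded_linear.has_vector_derivative[OF linear this]
  have "((\<lambda>x. columns2 (\<gamma> x) (D \<gamma> x)) has_vector_derivative columns2 (D \<gamma> x) (D (D \<gamma>) x)) (at x)"
    by simp
  moreover have "columns2 (D \<gamma> x) (D (D \<gamma>) x) = columns2 (\<gamma> x) (D \<gamma> x) ** frame_x_coeff q x t"
    by (simp add: DD assms(2) columns2_def transpose_def frame_x_coeff_def vec_eq_iff forall_2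
        matrix_matrix_mult_def sum_2)
  ultimately show ?thesis by simp
qed

lemma has_vector_derivative_shift:
  fixes f :: "real \<Rightarrow> 'b::real_normed_vector"
  assumes "(f has_vector_derivative f') (at (x + c))"
  shows "((\<lambda>x. f (x + c)) has_vector_derivative f') (at x)"
proof -
  have "((\<lambda>x. x + c) has_vector_derivative 1) (at x)"
    by (auto intro!: derivative_eq_intros)
  from vector_diff_chain_at[OF this assms] show ?thesis
    by (simp add: o_def)
qed

lemma Dx_periodic:
  assumes "\<And>x t. f (x + c) t = f x t"
  shows "Dx f (x + c) t = Dx f x t"
proof -
  \<comment> \<open>The two points admit the same vectors as derivatives, which settles the undifferentiable case
    as well: both sides are then the same arbitrary choice.\<close>
  have *: "((\<lambda>s. f s t) has_vector_derivative d) (at (x + c)) \<longleftrightarrow>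
           ((\<lambda>s. f s t) has_vector_derivative d) (at x)" for d
    using has_vector_derivative_shift[of "\<lambda>s. f s t" d x c]
      has_vector_derivative_shift[of "\<lambda>s. f s t" d "x + c" "- c"]
      assms[of "_ - c"] by (auto simp: assms)
  show ?thesis
    by (simp add: Dx_def D_def vector_derivative_def *)
qed

text \<open>The translate of \<open>g\<close> solves the same linear system. Agreement with \<open>g\<close> at one point spreads
  along the horizontal line through it, and from there along every vertical line.\<close>

lemma frame_periodic:
  assumes per: "\<And>x t. q (x + c) t = q x t"
    and g: "frame_solution q g" and det: "\<And>x t. det (g x t) = 1"
    and init: "g (x\<^sub>0 + c) t\<^sub>0 = g x\<^sub>0 t\<^sub>0"
  shows "g (x + c) t = g x t"
proof -
  have coeff: "frame_x_coeff q (x + c) t = frame_x_coeff q x t"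
    "frame_t_coeff q (x + c) t = frame_t_coeff q x t" for x t
    using Dx_periodic[of q c, OF per] Dx_periodic[of "Dx q" c, OF Dx_periodic[of q c, OF per]]
    by (simp_all add: frame_x_coeff_def frame_t_coeff_def per)
  have at_t0: "g (x + c) t\<^sub>0 = g x t\<^sub>0"
  proof (rule frame_unique[where F = "\<lambda>x. g (x + c) t\<^sub>0" and G = "\<lambda>x. g x t\<^sub>0"
        and A = "\<lambda>x. frame_x_coeff q x t\<^sub>0", OF _ _ _ _ init])
    show "((\<lambda>x. g (x + c) t\<^sub>0) has_vector_derivative g (x + c) t\<^sub>0 ** frame_x_coeff q x t\<^sub>0) (at x)"
      for x
      using has_vector_derivative_shift[of "\<lambda>x. g x t\<^sub>0",
          OF frame_solution_derivatives(1)[OF g, of t\<^sub>0 "x + c"]]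
      by (simp only: coeff)
  qed (simp_all add: frame_solution_derivatives[OF g] trace_frame_coeffs det)
  show ?thesis
  proof (rule frame_unique[where F = "g (x + c)" and G = "g x" and A = "frame_t_coeff q x",
        OF _ _ _ _ at_t0])
    show "(g (x + c) has_vector_derivative g (x + c) t ** frame_t_coeff q x t) (at t)" for t
      using frame_solution_derivatives(2)[OF g, of "x + c" t] by (simp only: coeff)
  qed (simp_all add: frame_solution_derivatives[OF g] trace_frame_coeffs det)
qed

theorem theorem2p10:
  fixes \<gamma>0 :: "real \<Rightarrow> real^2" and q0 :: "real \<Rightarrow> real"
    and q :: "real \<Rightarrow> real \<Rightarrow> real"
    and g :: "real \<Rightarrow> real \<Rightarrow> real^2^2"
    and \<gamma> :: "real \<Rightarrow> real \<Rightarrow> real^2"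
  assumes "\<gamma>0 \<in> M2_S1"
    and "is_central_affine_curvature q0 \<gamma>0"
    and "KdV_solution q"
    and "\<And>x t. q (x + 2 * pi) t = q x t"
    and "\<And>x. q x 0 = q0 x"
    and "\<And>x t. det (g x t) = 1"
    and "frame_solution q g"
    and "g 0 0 = columns2 (\<gamma>0 0) (D \<gamma>0 0)"
    and "\<And>x t. \<gamma> x t = g x t *v vector [1, 0]"
  shows "curve_flow_solution q \<gamma> \<and>
         (\<forall>x. \<gamma> x 0 = \<gamma>0 x) \<and>
         (\<forall>x t. \<gamma> (x + 2 * pi) t = \<gamma> x t)"
proof -
  let ?frame0 = "\<lambda>x. columns2 (\<gamma>0 x) (D \<gamma>0 x)"
  have \<gamma>: "\<gamma> = (\<lambda>x t. g x t *v vector [1, 0])"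
    using assms(9) by blast
  have flow: "curve_flow_solution q \<gamma>"
    unfolding \<gamma> using assms(3,6,7)
    by (intro frame_solution_imp_curve_flow_solution) (simp_all add: KdV_solution_def)
  have frame0: "?frame0 x = g x 0" for x
  proof (rule frame_unique[where F = ?frame0 and G = "\<lambda>x. g x 0"
        and A = "\<lambda>x. frame_x_coeff q x 0" and a = 0])
    show "(?frame0 has_vector_derivative ?frame0 x ** frame_x_coeff q x 0) (at x)" for x
      using assms(5) by (intro central_affine_frame_derivative[OF assms(2)]) simp
  qed (simp_all add: frame_solution_derivatives[OF assms(7)] trace_frame_coeffs assms(6,8))
  have init: "\<gamma> x 0 = \<gamma>0 x" for x
    by (simp add: \<gamma> frame0[symmetric] columns2_def transpose_def vec_eq_iff forall_2
        matrix_vector_mult_def sum_2)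
  \<comment> \<open>Along \<open>t = 0\<close> the frame is that of \<open>\<gamma>0\<close>, so the period of \<open>\<gamma>0\<close> and of its derivative gives one
    point where \<open>g\<close> agrees with its translate.\<close>
  have periodic0: "\<gamma>0 (x + 2 * pi) = \<gamma>0 x" for x
    using assms(1) by (simp add: M2_S1_def)
  have "D \<gamma>0 (0 + 2 * pi) = D \<gamma>0 0"
    using Dx_periodic[of "\<lambda>x _. \<gamma>0 x" "2 * pi" 0, OF periodic0] by (simp add: Dx_def)
  then have "g (0 + 2 * pi) 0 = g 0 0"
    using periodic0[of 0] by (simp add: frame0[symmetric])
  then have "g (x + 2 * pi) t = g x t" for x t
    by (rule frame_periodic[of q "2 * pi", OF assms(4,7,6)])
  then show ?thesis
    using flow init by (simp add: \<gamma>)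
qed

end
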